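(* Every isolated eigenvalue $\mu\in(\zeta^-,\zeta^+)$ of finite multiplicity and of negative type of the operator function $\lambda\mapsto[T(\lambda)]^\bullet$ is an isolated eigenvalue of negative type and of the same multiplicity for the transfer operator function $S(\lambda)=T_{11}(\lambda)-T_{12}(\lambda)[T_{22}(\lambda)]^{-1}T_{21}(\lambda)$.
   Context: Let $\mathfrak H=\mathfrak H_1\oplus\mathfrak H_2$ be Hilbert spaces, $\mathfrak D=\mathfrak D_1\oplus\mathfrak D_2$ Hilbert spaces with injective bounded embeddings $I_k\colon\mathfrak D_k\to\mathfrak H_k$ having dense ranges, $I=I_1\oplus I_2$, $\mathfrak D^*$ the dual of $\mathfrak D$. Let $T\colon[\zeta^-,\zeta^+]\to\mathcal B(\mathfrak D,\mathfrak D^* )$ be an operator function, smooth in the strong operator topology, with block entries $T_{jk}(\lambda)$, such that for every $\lambda\in[\zeta^-,\zeta^+]$ the operator $[T(\lambda)]^\bullet=(I^* )^{-1}T(\lambda)I^{-1}$ is self-adjoint in $\mathfrak H$. Assume: (1) there is $\varepsilon>0$ such that $\langle T_{22}(\lambda)y,y\rangle\le-\varepsilon\|y\|^2_{\mathfrak D_2}$ for all $y\in\mathfrak D_2$ and all $\lambda\in[\zeta^-,\zeta^+]$; (2) the function $S(\lambda)=T_{11}(\lambda)-T_{12}(\lambda)[T_{22}(\lambda)]^{-1}T_{21}(\lambda)$ on $[\zeta^-,\zeta^+]$ is continuous in the uniform operator topology and its values are compact perturbations of uniformly positive operators. An eigenvalue $\mu\in(\zeta^-,\zeta^+)$ of $\lambda\mapsto[T(\lambda)]^\bullet$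 is of negative type if for every nonzero $y\in\ker[T(\mu)]^\bullet$ the function $\lambda\mapsto\langle[T(\lambda)]^\bullet y,y\rangle_{\mathfrak H}$ is defined on an interval containing $\mu$ and has strictly negative derivative at $\mu$ (analogously for $S$, using $\langle S(\lambda)y,y\rangle$, $y\in\ker S(\mu)$). *)

theory Defs
  imports "HOL-Analysis.Analysis"
begin

(* D = 'd1 x 'd2, H = 'h1 x 'h2, I = I1 + I2.
  The dual Dstar is the type of bounded linear functionals ('d1 x 'd2) \<Rightarrow>L real,
  so an operator function T : [zm,zp] -> B(D,Dstar) has type
  real \<Rightarrow> (('d1 x 'd2) \<Rightarrow>L (('d1 x 'd2) \<Rightarrow>L real)). *)

type_synonym ('d1,'d2) opfun = "real \<Rightarrow> (('d1 \<times> 'd2) \<Rightarrow>\<^sub>L (('d1 \<times> 'd2) \<Rightarrow>\<^sub>L real))"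

definition frm :: "('d1::real_normed_vector,'d2::real_normed_vector) opfun \<Rightarrow> real
    \<Rightarrow> 'd1 \<times> 'd2 \<Rightarrow> 'd1 \<times> 'd2 \<Rightarrow> real" where
  "frm T l x y = blinfun_apply (blinfun_apply (T l) x) y"

definition embI :: "('d1::real_normed_vector \<Rightarrow>\<^sub>L 'h1::real_normed_vector)
    \<Rightarrow> ('d2::real_normed_vector \<Rightarrow>\<^sub>L 'h2::real_normed_vector) \<Rightarrow> 'd1 \<times> 'd2 \<Rightarrow> 'h1 \<times> 'h2" where
  "embI I1 I2 d = (blinfun_apply I1 (fst d), blinfun_apply I2 (snd d))"

definition smooth_on :: "real set \<Rightarrow> (real \<Rightarrow> 'b::real_normed_vector) \<Rightarrow> bool" where
  "smooth_on A f \<longleftrightarrow> (\<exists>F. F 0 = f \<and>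
      (\<forall>n. \<forall>t\<in>A. (F n has_vector_derivative F (Suc n) t) (at t within A)))"

definition strongly_smooth_on :: "real set \<Rightarrow> (real \<Rightarrow> ('a::real_normed_vector \<Rightarrow>\<^sub>L 'b::real_normed_vector)) \<Rightarrow> bool" where
  "strongly_smooth_on A T \<longleftrightarrow> (\<forall>x. smooth_on A (\<lambda>l. blinfun_apply (T l) x))"

(* The operator [T(l)]^bul = (I^star)^-^1 T(l) I^-^1 in H, where (I^star h)(e) = <h, I e>.
  Its domain consists of all x = I d such that T(l) d lies in the range of I^*. *)
definition bul_dom :: "('d1::real_normed_vector,'d2::real_normed_vector) opfun
    \<Rightarrow> ('d1 \<Rightarrow>\<^sub>L 'h1::real_inner) \<Rightarrow> ('d2 \<Rightarrow>\<^sub>L 'h2::real_inner) \<Rightarrow> real \<Rightarrow> ('h1 \<times> 'h2) set" where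
  "bul_dom T I1 I2 l = {x. \<exists>d. x = embI I1 I2 d \<and>
      (\<exists>h. \<forall>e. frm T l d e = inner h (embI I1 I2 e))}"

definition bul :: "('d1::real_normed_vector,'d2::real_normed_vector) opfun
    \<Rightarrow> ('d1 \<Rightarrow>\<^sub>L 'h1::real_inner) \<Rightarrow> ('d2 \<Rightarrow>\<^sub>L 'h2::real_inner) \<Rightarrow> real \<Rightarrow> 'h1 \<times> 'h2 \<Rightarrow> 'h1 \<times> 'h2" where
  "bul T I1 I2 l x = (THE h. \<forall>e. frm T l (inv (embI I1 I2) x) e = inner h (embI I1 I2 e))"

(* Self-adjointness of a (possibly unbounded) linear operator A with domain Dom:
  densely defined, linear, symmetric and Dom(A^star) <= Dom(A). *)
definition selfadjoint_op :: "'h::real_inner set \<Rightarrow> ('h \<Rightarrow> 'h) \<Rightarrow> bool" where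
  "selfadjoint_op Dom A \<longleftrightarrow> subspace Dom \<and> closure Dom = UNIV \<and>
     (\<forall>x\<in>Dom. \<forall>y\<in>Dom. \<forall>a b. A (a *\<^sub>R x + b *\<^sub>R y) = a *\<^sub>R A x + b *\<^sub>R A y) \<and>
     (\<forall>x\<in>Dom. \<forall>y\<in>Dom. inner (A x) y = inner x (A y)) \<and>
     (\<forall>y z. (\<forall>x\<in>Dom. inner (A x) y = inner x z) \<longrightarrow> y \<in> Dom)"

definition zero_in_resolvent :: "'h::real_normed_vector set \<Rightarrow> ('h \<Rightarrow> 'h) \<Rightarrow> bool" where
  "zero_in_resolvent Dom A \<longleftrightarrow> (\<exists>B::'h \<Rightarrow>\<^sub>L 'h.
     (\<forall>h. blinfun_apply B h \<in> Dom \<and> A (blinfun_apply B h) = h) \<and>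
     (\<forall>x\<in>Dom. blinfun_apply B (A x) = x))"

definition fin_dim :: "'a::real_vector set \<Rightarrow> bool" where
  "fin_dim V \<longleftrightarrow> (\<exists>B. finite B \<and> span B = V)"

definition bul_ker where
  "bul_ker T I1 I2 l = {x \<in> bul_dom T I1 I2 l. bul T I1 I2 l x = 0}"

definition bul_isolated_eigenvalue where
  "bul_isolated_eigenvalue zm zp T I1 I2 mu \<longleftrightarrow>
     bul_ker T I1 I2 mu \<noteq> {0} \<and>
     (\<exists>\<epsilon>>0. \<forall>l\<in>{zm..zp}. l \<noteq> mu \<and> \<bar>l - mu\<bar> < \<epsilon> \<longrightarrow>
         zero_in_resolvent (bul_dom T I1 I2 l) (bul T I1 I2 l))"

definition bul_negative_type where
  "bul_negative_type zm zp T I1 I2 mu \<longleftrightarrow>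
     (\<forall>y\<in>bul_ker T I1 I2 mu. y \<noteq> 0 \<longrightarrow>
        (\<exists>J. is_interval J \<and> mu \<in> J \<and> J \<subseteq> {zm..zp} \<and> J \<noteq> {mu} \<and>
             (\<forall>l\<in>J. y \<in> bul_dom T I1 I2 l) \<and>
             (\<exists>d<0. ((\<lambda>l. inner (bul T I1 I2 l y) y) has_real_derivative d) (at mu within J))))"

(* Schur complement S(l) = T11(l) - T12(l) T22(l)^-^1 T21(l) : B(D1,D1star):
  T22(l)^-^1 T21(l) x is the unique y with T22(l) y = T21(l) x. *)
definition schur_sol :: "('d1::real_normed_vector,'d2::real_normed_vector) opfun \<Rightarrow> real \<Rightarrow> 'd1 \<Rightarrow> 'd2" where
  "schur_sol T l x = (THE y. \<forall>w. frm T l (0, y) (0, w) = frm T l (x, 0) (0, w))"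

definition schur :: "('d1::real_normed_vector,'d2::real_normed_vector) opfun \<Rightarrow> real \<Rightarrow> ('d1 \<Rightarrow>\<^sub>L ('d1 \<Rightarrow>\<^sub>L real))" where
  "schur T l = Blinfun (\<lambda>x. Blinfun (\<lambda>z. frm T l (x, 0) (z, 0) - frm T l (0, schur_sol T l x) (z, 0)))"

definition compact_operator :: "('a::real_normed_vector \<Rightarrow>\<^sub>L 'b::real_normed_vector) \<Rightarrow> bool" where
  "compact_operator K \<longleftrightarrow> compact (closure (blinfun_apply K ` cball 0 1))"

definition uniformly_positive :: "('a::real_normed_vector \<Rightarrow>\<^sub>L ('a \<Rightarrow>\<^sub>L real)) \<Rightarrow> bool" where
  "uniformly_positive P \<longleftrightarrow> (\<exists>c>0. \<forall>x. blinfun_apply (blinfun_apply P x) x \<ge> c * (norm x)\<^sup>2)"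

definition op_ker :: "('a::real_normed_vector \<Rightarrow>\<^sub>L 'b::real_normed_vector) \<Rightarrow> 'a set" where
  "op_ker A = {x. blinfun_apply A x = 0}"

definition bounded_invertible :: "('a::real_normed_vector \<Rightarrow>\<^sub>L 'b::real_normed_vector) \<Rightarrow> bool" where
  "bounded_invertible A \<longleftrightarrow> (\<exists>B::'b \<Rightarrow>\<^sub>L 'a.
     (\<forall>x. blinfun_apply B (blinfun_apply A x) = x) \<and> (\<forall>y. blinfun_apply A (blinfun_apply B y) = y))"

definition op_isolated_eigenvalue :: "real \<Rightarrow> real \<Rightarrow> (real \<Rightarrow> ('a::real_normed_vector \<Rightarrow>\<^sub>L ('a \<Rightarrow>\<^sub>L real))) \<Rightarrow> real \<Rightarrow> bool" where
  "op_isolated_eigenvalue zm zp S mu \<longleftrightarrow>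
     op_ker (S mu) \<noteq> {0} \<and>
     (\<exists>\<epsilon>>0. \<forall>l\<in>{zm..zp}. l \<noteq> mu \<and> \<bar>l - mu\<bar> < \<epsilon> \<longrightarrow> bounded_invertible (S l))"

definition op_negative_type :: "real \<Rightarrow> real \<Rightarrow> (real \<Rightarrow> ('a::real_normed_vector \<Rightarrow>\<^sub>L ('a \<Rightarrow>\<^sub>L real))) \<Rightarrow> real \<Rightarrow> bool" where
  "op_negative_type zm zp S mu \<longleftrightarrow>
     (\<forall>y\<in>op_ker (S mu). y \<noteq> 0 \<longrightarrow>
        (\<exists>J. is_interval J \<and> mu \<in> J \<and> J \<subseteq> {zm..zp} \<and> J \<noteq> {mu} \<and>
             (\<exists>d<0. ((\<lambda>l. blinfun_apply (blinfun_apply (S l) y) y) has_real_derivative d) (at mu within J))))"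

end

theory Submission
  imports Defs
begin

text \<open>Coercivity of the lower block \<open>T\<^sub>2\<^sub>2\<close> makes it boundedly invertible (Lax--Milgram), so the
  Schur complement \<open>S\<close> is well defined and \<open>T(\<lambda>)(x, y) = 0\<close> iff \<open>S(\<lambda>)x = 0\<close> and
  \<open>y = -T\<^sub>2\<^sub>2(\<lambda>)\<^sup>-\<^sup>1T\<^sub>2\<^sub>1(\<lambda>)x\<close>. At \<open>\<lambda> = \<mu>\<close> the lift \<open>x \<mapsto> I(x, -T\<^sub>2\<^sub>2(\<mu>)\<^sup>-\<^sup>1T\<^sub>2\<^sub>1(\<mu>)x)\<close>
  is therefore an injective linear map of \<open>ker S(\<mu>)\<close> onto \<open>ker [T(\<mu>)]\<^sup>\<bullet>\<close>, which gives the
  multiplicities.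

  For \<open>\<lambda> \<noteq> \<mu>\<close> close to \<open>\<mu>\<close>, \<open>0\<close> is in the resolvent set of \<open>[T(\<lambda>)]\<^sup>\<bullet>\<close>. Then \<open>T(\<lambda>)\<close>
  is injective with dense range in the dual, so \<open>S(\<lambda>)\<close> is injective and hence, being a compact
  perturbation of a uniformly positive operator, bounded below. This transfers to \<open>T(\<lambda>)\<close>, whose
  range is then closed and dense, i.e. everything, so that \<open>S(\<lambda>)\<close> is onto as well; the
  self-adjointness of \<open>[T(\<lambda>)]\<^sup>\<bullet>\<close> makes the form of \<open>T(\<lambda>)\<close> symmetric.

  Finally, for \<open>y \<in> ker S(\<mu>)\<close> and its lift \<open>d\<close>, symmetry and coercivity give
  \<open>\<epsilon> |\<langle>S(\<lambda>)y, y\<rangle> - \<langle>T(\<lambda>)d, d\<rangle>| \<le> \<parallel>T(\<lambda>)d\<parallel>\<^sup>2\<close>, which is \<open>O(|\<lambda> - \<mu>|\<^sup>2)\<close> because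
  \<open>T(\<mu>)d = 0\<close>; so both forms have the same derivative at \<open>\<mu>\<close>, and negative type is inherited.\<close>

section \<open>Operators bounded below\<close>

lemma Cauchy_if_bounded_below:
  assumes "bounded_linear L" and "0 < c" and "\<And>x. c * norm x \<le> norm (L x)"
    and "Cauchy (\<lambda>n. L (x n))"
  shows "Cauchy x"
proof (rule metric_CauchyI)
  interpret L: bounded_linear L by fact
  fix e :: real
  assume "0 < e"
  with assms(2) obtain N where N: "\<And>m n. m \<ge> N \<Longrightarrow> n \<ge> N \<Longrightarrow> dist (L (x m)) (L (x n)) < c * e"
    using metric_CauchyD[OF assms(4), of "c * e"] by auto
  have "dist (x m) (x n) < e" if "m \<ge> N" "n \<ge> N" for m n
  proof -
    have "c * norm (x m - x n) < c * e"
      using assms(3)[of "x m - x n"] N[OF that] by (simp add: dist_norm L.diff)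
    thus ?thesis using assms(2) by (simp add: dist_norm)
  qed
  thus "\<exists>N. \<forall>m\<ge>N. \<forall>n\<ge>N. dist (x m) (x n) < e" by blast
qed

lemma closed_range_if_bounded_below:
  fixes L :: "'a::{real_normed_vector,complete_space} \<Rightarrow> 'b::real_normed_vector"
  assumes "bounded_linear L" and "0 < c" and "\<And>x. c * norm x \<le> norm (L x)"
  shows "closed (range L)"
  unfolding closed_sequential_limits
proof (intro allI impI, elim conjE)
  fix s y
  assume "\<forall>n. s n \<in> range L" and "s \<longlonglongrightarrow> y"
  then obtain x where x: "s = (\<lambda>n. L (x n))"
    by (metis image_iff)
  have "Cauchy x"
    using Cauchy_if_bounded_below[OF assms] LIMSEQ_imp_Cauchy[OF \<open>s \<longlonglongrightarrow> y\<close>] x by blast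
  then obtain z where "x \<longlonglongrightarrow> z"
    using convergent_eq_Cauchy by blast
  hence "s \<longlonglongrightarrow> L z"
    unfolding x by (rule bounded_linear.tendsto[OF assms(1)])
  with \<open>s \<longlonglongrightarrow> y\<close> have "y = L z"
    using LIMSEQ_unique by blast
  thus "y \<in> range L" by simp
qed

lemma bounded_invertible_if_bounded_below_surj:
  fixes S :: "'a::real_normed_vector \<Rightarrow>\<^sub>L 'b::real_normed_vector"
  assumes "0 < c" and below: "\<And>x. c * norm x \<le> norm (S x)" and "surj S"
  shows "bounded_invertible S"
proof -
  have "inj S"
  proof (rule injI)
    fix x y
    assume "S x = S y"
    hence "c * norm (x - y) \<le> 0"
      using below[of "x - y"] by (simp add: blinfun.diff_right)
    thus "x = y" using \<open>0 < c\<close> by (simp add: mult_le_0_iff)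
  qed
  define g where "g = inv S"
  have Sg: "S (g y) = y" for y
    unfolding g_def using \<open>surj S\<close> by (rule surj_f_inv_f)
  have gS: "g (S x) = x" for x
    unfolding g_def using \<open>inj S\<close> by (rule inv_f_f)
  have "bounded_linear g"
  proof (rule bounded_linear_intro)
    show "g (y + z) = g y + g z" for y z
      by (metis Sg gS blinfun.add_right)
    show "g (r *\<^sub>R y) = r *\<^sub>R g y" for r y
      by (metis Sg gS blinfun.scaleR_right)
    show "norm (g y) \<le> norm y * (1 / c)" for y
      using below[of "g y"] \<open>0 < c\<close> by (simp add: Sg field_simps)
  qed
  thus ?thesis
    unfolding bounded_invertible_def
    by (intro exI[of _ "Blinfun g"]) (simp add: bounded_linear_Blinfun_apply gS Sg)
qed

lemma uniformly_positive_bounded_below: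
  fixes P :: "'a::real_normed_vector \<Rightarrow>\<^sub>L ('a \<Rightarrow>\<^sub>L real)"
  assumes "uniformly_positive P"
  obtains c where "0 < c" and "\<And>x. c * norm x \<le> norm (P x)"
proof -
  obtain c where "0 < c" and c: "\<And>x. c * (norm x)\<^sup>2 \<le> P x x"
    using assms unfolding uniformly_positive_def by blast
  have "c * norm x \<le> norm (P x)" for x
  proof -
    have "c * norm x * norm x \<le> norm (P x) * norm x"
      using c[of x] norm_blinfun[of "P x" x] by (simp add: power2_eq_square)
    thus ?thesis by (cases "x = 0") auto
  qed
  with \<open>0 < c\<close> show ?thesis by (rule that)
qed

lemma unit_sequence_if_not_bounded_below:
  fixes L :: "'a::real_normed_vector \<Rightarrow> 'b::real_normed_vector"
  assumes "linear L" and "\<nexists>c. 0 < c \<and> (\<forall>x. c * norm x \<le> norm (L x))"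
  obtains xs where "\<And>n. norm (xs n) = 1" and "(\<lambda>n. L (xs n)) \<longlonglongrightarrow> 0"
proof -
  have "\<exists>y. norm y = 1 \<and> norm (L y) < 1 / Suc n" for n
  proof -
    obtain x where x: "norm (L x) < 1 / Suc n * norm x"
      using assms(2) by (metis not_le of_nat_0_less_iff zero_less_Suc zero_less_divide_1_iff)
    hence "x \<noteq> 0" by auto
    have "norm (L ((1 / norm x) *\<^sub>R x)) = norm (L x) / norm x"
      by (simp add: linear_scale[OF assms(1)])
    also have "\<dots> < 1 / Suc n"
      using x \<open>x \<noteq> 0\<close> by (simp add: divide_less_eq)
    finally show ?thesis
      using \<open>x \<noteq> 0\<close> by (intro exI[of _ "(1 / norm x) *\<^sub>R x"]) simp
  qed
  then obtain xs where xs: "\<And>n. norm (xs n) = 1" "\<And>n. norm (L (xs n)) < 1 / Suc n"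
    by metis
  have "(\<lambda>n. L (xs n)) \<longlonglongrightarrow> 0"
  proof (rule Lim_null_comparison)
    show "\<forall>\<^sub>F n in sequentially. norm (L (xs n)) \<le> 1 / Suc n"
      using xs(2) by (simp add: less_imp_le)
    show "(\<lambda>n. 1 / real (Suc n)) \<longlonglongrightarrow> 0"
      using LIMSEQ_inverse_real_of_nat by (simp add: inverse_eq_divide)
  qed
  with xs(1) show ?thesis by (rule that)
qed

text \<open>Along a unit sequence on which \<open>P + K\<close> tends to zero, compactness of \<open>K\<close> gives a
  subsequence on which \<open>P\<close> converges; as \<open>P\<close> is bounded below, the subsequence itself converges
  to a unit vector in the kernel.\<close>

lemma bounded_below_if_inj_compact_perturbation:
  fixes P K :: "'a::{real_normed_vector,complete_space} \<Rightarrow>\<^sub>L ('a \<Rightarrow>\<^sub>L real)"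
  assumes "uniformly_positive P" and "compact_operator K"
    and inj: "\<And>x. (P + K) x = 0 \<Longrightarrow> x = 0"
  obtains c where "0 < c" and "\<And>x. c * norm x \<le> norm ((P + K) x)"
proof (rule ccontr)
  assume "\<not> thesis"
  with that have "\<nexists>c. 0 < c \<and> (\<forall>x. c * norm x \<le> norm ((P + K) x))"
    by blast
  then obtain xs where unit: "\<And>n. norm (xs n) = 1" and null: "(\<lambda>n. (P + K) (xs n)) \<longlonglongrightarrow> 0"
    using unit_sequence_if_not_bounded_below[OF bounded_linear.linear[OF blinfun.bounded_linear_right]] by blast
  have in_closure: "\<forall>n. K (xs n) \<in> closure (K ` cball 0 1)"
  proof
    fix n
    have "xs n \<in> cball 0 1" using unit[of n] by simp
    thus "K (xs n) \<in> closure (K ` cball 0 1)"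
      by (rule closure_subset[THEN subsetD, OF imageI])
  qed
  have "seq_compact (closure (K ` cball 0 1))"
    using \<open>compact_operator K\<close> unfolding compact_operator_def by (rule compact_imp_seq_compact)
  then obtain l r where r: "strict_mono r" and "((\<lambda>n. K (xs n)) \<circ> r) \<longlonglongrightarrow> l"
    using in_closure by (rule seq_compactE)
  hence Klim: "(\<lambda>n. K (xs (r n))) \<longlonglongrightarrow> l"
    by (simp add: o_def)
  have null_r: "(\<lambda>n. (P + K) (xs (r n))) \<longlonglongrightarrow> 0"
    using LIMSEQ_subseq_LIMSEQ[OF null r] by (simp add: o_def)
  have "(\<lambda>n. (P + K) (xs (r n)) - K (xs (r n))) \<longlonglongrightarrow> 0 - l"
    using null_r Klim by (rule tendsto_diff)
  hence P_Cauchy: "Cauchy (\<lambda>n. P (xs (r n)))"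
    by (intro LIMSEQ_imp_Cauchy) (simp add: plus_blinfun.rep_eq)
  obtain c where "0 < c" and P_below: "\<And>x. c * norm x \<le> norm (P x)"
    using uniformly_positive_bounded_below[OF assms(1)] by blast
  have "Cauchy (\<lambda>n. xs (r n))"
    by (rule Cauchy_if_bounded_below[OF blinfun.bounded_linear_right \<open>0 < c\<close> P_below P_Cauchy])
  then obtain x where lim: "(\<lambda>n. xs (r n)) \<longlonglongrightarrow> x"
    using convergent_eq_Cauchy by blast
  have "norm x = 1"
    using tendsto_norm[OF lim] unit by (simp add: LIMSEQ_const_iff)
  moreover have "(P + K) x = 0"
    using bounded_linear.tendsto[OF blinfun.bounded_linear_right lim] null_r by (rule LIMSEQ_unique)
  ultimately show False
    using inj by fastforce
qed

section \<open>Hilbert spaces\<close>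

lemma parallelogram_law:
  fixes a b :: "'a::real_inner"
  shows "(norm (a + b))\<^sup>2 + (norm (a - b))\<^sup>2 = 2 * (norm a)\<^sup>2 + 2 * (norm b)\<^sup>2"
  by (simp add: power2_norm_eq_inner inner_add_left inner_add_right inner_diff_left
      inner_diff_right inner_commute)

lemma parallelogram_dist_bound:
  fixes x a b :: "'a::real_inner"
  assumes "d \<le> norm (x - (1/2) *\<^sub>R (a + b))" and "0 \<le> d"
  shows "(norm (a - b))\<^sup>2 \<le> 2 * (norm (x - a))\<^sup>2 + 2 * (norm (x - b))\<^sup>2 - 4 * d\<^sup>2"
proof -
  have "norm ((x - a) + (x - b)) = 2 * norm (x - (1/2) *\<^sub>R (a + b))"
  proof -
    have "(x - a) + (x - b) = 2 *\<^sub>R (x - (1/2) *\<^sub>R (a + b))"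
      by (simp add: algebra_simps scaleR_2)
    thus ?thesis by simp
  qed
  hence "4 * d\<^sup>2 \<le> (norm ((x - a) + (x - b)))\<^sup>2"
    using assms by (simp add: power2_eq_square mult_mono)
  moreover have "(norm ((x - a) - (x - b)))\<^sup>2 = (norm (a - b))\<^sup>2"
    by (simp add: norm_minus_commute)
  ultimately show ?thesis
    using parallelogram_law[of "x - a" "x - b"] by linarith
qed

lemma minimizing_sequence_Cauchy:
  fixes S :: "'a::real_inner set"
  assumes "convex S" and "0 \<le> d" and d_le: "\<And>y. y \<in> S \<Longrightarrow> d \<le> norm (x - y)"
    and mm_in: "\<And>n. mm n \<in> S" and mm_close: "\<And>n. (norm (x - mm n))\<^sup>2 < d\<^sup>2 + 1 / Suc n"
  shows "Cauchy mm"
proof (rule metric_CauchyI)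
  have dist_sq: "(norm (mm k - mm n))\<^sup>2 \<le> 2 / Suc k + 2 / Suc n" for k n
  proof -
    have "(1/2) *\<^sub>R (mm k + mm n) \<in> S"
      using convexD[OF assms(1) mm_in mm_in, of "1/2" "1/2"] by (simp add: scaleR_right_distrib)
    from parallelogram_dist_bound[OF d_le[OF this] \<open>0 \<le> d\<close>]
    show ?thesis using mm_close[of k] mm_close[of n] by linarith
  qed
  fix e :: real
  assume "0 < e"
  then obtain N where N: "inverse (real (Suc N)) < e\<^sup>2 / 4"
    using reals_Archimedean[of "e\<^sup>2 / 4"] by auto
  have "dist (mm k) (mm n) < e" if "k \<ge> N" "n \<ge> N" for k n
  proof -
    have "2 / Suc k \<le> 2 / Suc N" and "2 / Suc n \<le> 2 / Suc N"
      using that by (simp_all add: frac_le)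
    hence "2 / Suc k + 2 / Suc n \<le> 4 * inverse (real (Suc N))"
      by (simp only: divide_inverse)
    with dist_sq[of k n] N have "(norm (mm k - mm n))\<^sup>2 < e\<^sup>2"
      by linarith
    thus ?thesis
      using \<open>0 < e\<close> by (simp add: dist_norm power_less_imp_less_base)
  qed
  thus "\<exists>N. \<forall>k\<ge>N. \<forall>n\<ge>N. dist (mm k) (mm n) < e" by blast
qed

lemma nearest_point_exists:
  fixes S :: "'a::{real_inner,complete_space} set"
  assumes "closed S" and "convex S" and "S \<noteq> {}"
  obtains m where "m \<in> S" and "\<And>y. y \<in> S \<Longrightarrow> norm (x - m) \<le> norm (x - y)"
proof -
  define d where "d = Inf ((\<lambda>y. norm (x - y)) ` S)"
  have bdd: "bdd_below ((\<lambda>y. norm (x - y)) ` S)"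
    by (rule bdd_belowI[of _ 0]) auto
  have d_le: "d \<le> norm (x - y)" if "y \<in> S" for y
    unfolding d_def using that bdd by (auto intro: cInf_lower)
  have "0 \<le> d"
    unfolding d_def using assms(3) by (auto intro: cInf_greatest)
  have "\<exists>y\<in>S. (norm (x - y))\<^sup>2 < d\<^sup>2 + 1 / Suc n" for n
  proof -
    have "d < sqrt (d\<^sup>2 + 1 / Suc n)"
      using \<open>0 \<le> d\<close> by (intro real_less_rsqrt) simp
    then obtain y where "y \<in> S" and "norm (x - y) < sqrt (d\<^sup>2 + 1 / Suc n)"
      using cInf_less_iff[OF _ bdd] assms(3) unfolding d_def by auto
    hence "(norm (x - y))\<^sup>2 < (sqrt (d\<^sup>2 + 1 / Suc n))\<^sup>2"
      by (intro power_strict_mono) auto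
    thus ?thesis
      using \<open>y \<in> S\<close> by auto
  qed
  then obtain mm where mm_in: "\<And>n. mm n \<in> S"
    and mm_close: "\<And>n. (norm (x - mm n))\<^sup>2 < d\<^sup>2 + 1 / Suc n"
    by metis
  with assms(2) \<open>0 \<le> d\<close> d_le obtain m where lim: "mm \<longlonglongrightarrow> m"
    using minimizing_sequence_Cauchy convergent_eq_Cauchy by metis
  have m_in: "m \<in> S"
    using closed_sequentially[OF assms(1) _ lim] mm_in by blast
  have "(norm (x - m))\<^sup>2 \<le> d\<^sup>2"
  proof (rule LIMSEQ_le)
    show "(\<lambda>n. (norm (x - mm n))\<^sup>2) \<longlonglongrightarrow> (norm (x - m))\<^sup>2"
      by (intro tendsto_intros lim)
    show "(\<lambda>n. d\<^sup>2 + 1 / Suc n) \<longlonglongrightarrow> d\<^sup>2"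
      using LIMSEQ_inverse_real_of_nat_add[of "d\<^sup>2"] by (simp add: inverse_eq_divide)
    show "\<exists>N. \<forall>n\<ge>N. (norm (x - mm n))\<^sup>2 \<le> d\<^sup>2 + 1 / Suc n"
      using mm_close by (auto intro: less_imp_le)
  qed
  hence "norm (x - m) \<le> d"
    using \<open>0 \<le> d\<close> by (rule power2_le_imp_le)
  show ?thesis
  proof (rule that[OF m_in])
    fix y
    assume "y \<in> S"
    from d_le[OF this] show "norm (x - m) \<le> norm (x - y)"
      using \<open>norm (x - m) \<le> d\<close> by linarith
  qed
qed

lemma nearest_point_orthogonal:
  fixes M :: "'a::real_inner set"
  assumes "subspace M" and "m \<in> M" and "y \<in> M"
    and nearest: "\<And>y. y \<in> M \<Longrightarrow> norm (x - m) \<le> norm (x - y)"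
  shows "inner (x - m) y = 0"
proof (rule ccontr)
  assume "inner (x - m) y \<noteq> 0"
  hence "y \<noteq> 0" by auto
  define t where "t = inner (x - m) y / (norm y)\<^sup>2"
  have "m + t *\<^sub>R y \<in> M"
    using assms by (simp add: subspace_add subspace_scale)
  hence "(norm (x - m))\<^sup>2 \<le> (norm (x - (m + t *\<^sub>R y)))\<^sup>2"
    using nearest by (simp add: power_mono)
  also have "\<dots> = (norm (x - m))\<^sup>2 - 2 * t * inner (x - m) y + t\<^sup>2 * (norm y)\<^sup>2"
    unfolding power2_norm_eq_inner
    by (simp add: inner_diff_left inner_diff_right inner_commute algebra_simps power2_eq_square)
  also have "\<dots> = (norm (x - m))\<^sup>2 - (inner (x - m) y)\<^sup>2 / (norm y)\<^sup>2"
    using \<open>y \<noteq> 0\<close> by (simp add: t_def power2_eq_square field_simps)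
  finally have "(inner (x - m) y)\<^sup>2 / (norm y)\<^sup>2 \<le> 0" by simp
  thus False
    using \<open>inner (x - m) y \<noteq> 0\<close> \<open>y \<noteq> 0\<close> by (simp add: divide_le_0_iff)
qed

lemma orthogonal_projection_exists:
  fixes M :: "'a::{real_inner,complete_space} set"
  assumes "subspace M" and "closed M"
  obtains m where "m \<in> M" and "\<And>y. y \<in> M \<Longrightarrow> inner (x - m) y = 0"
proof -
  obtain m where "m \<in> M" and "\<And>y. y \<in> M \<Longrightarrow> norm (x - m) \<le> norm (x - y)"
    using nearest_point_exists[OF assms(2) subspace_imp_convex[OF assms(1)]] subspace_0[OF assms(1)]
    by blast
  with nearest_point_orthogonal[OF assms(1)] show ?thesis
    using that by blast
qed

lemma closed_subspace_eq_UNIV: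
  fixes M :: "'a::{real_inner,complete_space} set"
  assumes "subspace M" and "closed M"
    and "\<And>z. (\<And>y. y \<in> M \<Longrightarrow> inner z y = 0) \<Longrightarrow> z = 0"
  shows "M = UNIV"
proof -
  have "x \<in> M" for x
  proof -
    obtain m where "m \<in> M" and "\<And>y. y \<in> M \<Longrightarrow> inner (x - m) y = 0"
      using orthogonal_projection_exists[OF assms(1,2)] by blast
    with assms(3) have "x - m = 0" by blast
    with \<open>m \<in> M\<close> show ?thesis by simp
  qed
  thus ?thesis by auto
qed

lemma subspace_closure:
  fixes S :: "'a::real_normed_vector set"
  assumes "subspace S"
  shows "subspace (closure S)"
proof -
  have "x + y \<in> closure S" if "x \<in> closure S" and "y \<in> closure S" for x y
  proof -
    have "x + y \<in> closure S + closure S"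
      using that by (rule set_plus_intro)
    also have "\<dots> \<subseteq> closure (S + S)"
      by (rule closure_sum)
    also have "\<dots> \<subseteq> closure S"
      using assms by (intro closure_mono) (auto simp: set_plus_def subspace_add)
    finally show ?thesis .
  qed
  moreover have "c *\<^sub>R x \<in> closure S" if "x \<in> closure S" for c x
  proof -
    have "c *\<^sub>R x \<in> (*\<^sub>R) c ` closure S"
      using that by blast
    also have "\<dots> = closure ((*\<^sub>R) c ` S)"
      by (rule closure_scaleR)
    also have "\<dots> \<subseteq> closure S"
      using assms by (intro closure_mono) (auto simp: subspace_scale)
    finally show ?thesis .
  qed
  ultimately show ?thesis
    using assms closure_subset unfolding subspace_def by blast
qed

lemma orthogonal_dense_range_eq_zero:
  fixes E :: "'a \<Rightarrow> 'b::real_inner"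
  assumes "closure (range E) = UNIV" and "\<And>e. inner z (E e) = 0"
  shows "z = 0"
proof -
  have "closure (range E) \<subseteq> {y. inner z y = 0}"
    using assms(2) by (intro closure_minimal closed_hyperplane) auto
  hence "inner z z = 0"
    using assms(1) by blast
  thus ?thesis by simp
qed

lemma riesz_representation:
  fixes f :: "'a::{real_inner,complete_space} \<Rightarrow> real"
  assumes "bounded_linear f"
  obtains v where "\<And>x. f x = inner v x"
proof (cases "\<forall>x. f x = 0")
  case True
  thus ?thesis using that[of 0] by simp
next
  case False
  interpret f: bounded_linear f by fact
  define M where "M = {x. f x = 0}"
  have "subspace M" and "closed M"
    unfolding M_def
    by (simp_all add: linear_subspace_kernel[OF f.linear]
        closed_Collect_eq[OF linear_continuous_on[OF assms] continuous_on_const])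
  moreover have "M \<noteq> UNIV" using False unfolding M_def by auto
  ultimately obtain z where z_orth: "\<And>y. y \<in> M \<Longrightarrow> inner z y = 0" and "z \<noteq> 0"
    using closed_subspace_eq_UNIV by blast
  have "f z \<noteq> 0"
    using z_orth[of z] \<open>z \<noteq> 0\<close> unfolding M_def by auto
  have "f x = inner ((f z / (norm z)\<^sup>2) *\<^sub>R z) x" for x
  proof -
    have "x - (f x / f z) *\<^sub>R z \<in> M"
      using \<open>f z \<noteq> 0\<close> unfolding M_def by (simp add: f.diff f.scale)
    hence "inner z x = (f x / f z) * (norm z)\<^sup>2"
      using z_orth[of "x - (f x / f z) *\<^sub>R z"] by (simp add: inner_diff_right power2_norm_eq_inner)
    thus ?thesis using \<open>f z \<noteq> 0\<close> \<open>z \<noteq> 0\<close> by (simp add: field_simps)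
  qed
  thus ?thesis by (rule that)
qed

lemma bounded_bilinear_representation:
  fixes a :: "'a::real_normed_vector \<Rightarrow> 'b::{real_inner,complete_space} \<Rightarrow> real"
  assumes "bounded_bilinear a"
  obtains A where "bounded_linear A" and "\<And>y x. a y x = inner (A y) x"
proof -
  interpret a: bounded_bilinear a by fact
  have "\<forall>y. \<exists>v. \<forall>x. a y x = inner v x"
    using riesz_representation[OF a.bounded_linear_right] by metis
  then obtain A where A: "\<And>y x. a y x = inner (A y) x"
    by metis
  obtain K where "0 \<le> K" and K: "\<And>y x. norm (a y x) \<le> norm y * norm x * K"
    using a.nonneg_bounded by blast
  have "bounded_linear A"
  proof (rule bounded_linear_intro)
    show "A (y + z) = A y + A z" for y z
      by (rule vector_eq_rdot[THEN iffD1]) (simp add: A[symmetric] a.add_left inner_add_left)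
    show "A (r *\<^sub>R y) = r *\<^sub>R A y" for r y
      by (rule vector_eq_rdot[THEN iffD1]) (simp add: A[symmetric] a.scaleR_left)
    show "norm (A y) \<le> norm y * K" for y
    proof -
      have "norm (A y) * norm (A y) = a y (A y)"
        by (simp add: A dot_square_norm power2_eq_square)
      also have "\<dots> \<le> (norm y * K) * norm (A y)"
        using K[of y "A y"] by (simp add: mult_ac)
      finally show ?thesis
        using \<open>0 \<le> K\<close> by (cases "A y = 0") (auto simp: mult_le_cancel_right)
    qed
  qed
  with A show ?thesis by (intro that)
qed

theorem lax_milgram:
  fixes a :: "'a::{real_inner,complete_space} \<Rightarrow> 'a \<Rightarrow> real"
  assumes "bounded_bilinear a" and "0 < e" and coercive: "\<And>y. e * (norm y)\<^sup>2 \<le> \<bar>a y y\<bar>"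
    and "bounded_linear f"
  obtains y where "\<And>x. a y x = f x"
proof -
  obtain A where A: "bounded_linear A" and a_eq: "\<And>y x. a y x = inner (A y) x"
    using bounded_bilinear_representation[OF assms(1)] by blast
  have "e * norm y \<le> norm (A y)" for y
  proof -
    have "e * norm y * norm y \<le> norm (A y) * norm y"
      using coercive[of y] Cauchy_Schwarz_ineq2[of "A y" y]
      by (simp add: a_eq power2_eq_square)
    thus ?thesis by (cases "y = 0") auto
  qed
  hence "closed (range A)"
    by (rule closed_range_if_bounded_below[OF A \<open>0 < e\<close>])
  have "subspace (range A)"
    using linear_subspace_image[OF bounded_linear.linear[OF A] subspace_UNIV] .
  moreover note \<open>closed (range A)\<close>
  moreover have "z = 0" if "\<And>y. y \<in> range A \<Longrightarrow> inner z y = 0" for z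
  proof -
    have "e * (norm z)\<^sup>2 \<le> 0"
      using coercive[of z] that[of "A z"] by (simp add: a_eq inner_commute)
    thus ?thesis using \<open>0 < e\<close> by (simp add: mult_le_0_iff)
  qed
  ultimately have "range A = UNIV"
    by (rule closed_subspace_eq_UNIV)
  obtain v where "\<And>x. f x = inner v x"
    using riesz_representation[OF assms(4)] by blast
  moreover obtain y where "A y = v"
    using \<open>range A = UNIV\<close> by (metis UNIV_I imageE)
  ultimately show ?thesis
    using that a_eq by metis
qed

lemma adjoint_range_dense_in_dual:
  fixes E :: "'d::{real_inner,complete_space} \<Rightarrow> 'h::real_inner"
  assumes "bounded_linear E" and "inj E" and "bounded_linear f" and "0 < \<eta>"
  obtains h where "\<And>e. \<bar>f e - inner h (E e)\<bar> \<le> \<eta> * norm e"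
proof -
  interpret E: bounded_linear E by fact
  have "bounded_bilinear (\<lambda>h e. inner h (E e))"
    by (rule bounded_bilinear.comp[OF bounded_bilinear_inner bounded_linear_ident assms(1)])
  then obtain E' where E': "bounded_linear E'" and adj: "\<And>h e. inner h (E e) = inner (E' h) e"
    by (rule bounded_bilinear_representation) auto
  have "closure (range E') = UNIV"
  proof (rule closed_subspace_eq_UNIV)
    show "subspace (closure (range E'))"
      by (intro subspace_closure linear_subspace_image bounded_linear.linear[OF E'] subspace_UNIV)
    show "z = 0" if "\<And>y. y \<in> closure (range E') \<Longrightarrow> inner z y = 0" for z
    proof -
      have "E' (E z) \<in> closure (range E')"
        using closure_subset[of "range E'"] by blast
      from that[OF this] have "inner (E z) (E z) = 0"
        using inner_commute[of z "E' (E z)"] adj[of "E z" z] by simp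
      hence "E z = E 0" by simp
      thus "z = 0" by (rule injD[OF \<open>inj E\<close>])
    qed
  qed simp
  obtain v where v: "\<And>e. f e = inner v e"
    using riesz_representation[OF assms(3)] by blast
  have "v \<in> closure (range E')"
    using \<open>closure (range E') = UNIV\<close> by simp
  then obtain h where "dist (E' h) v < \<eta>"
    using \<open>0 < \<eta>\<close> by (auto simp: closure_approachable)
  have "\<bar>f e - inner h (E e)\<bar> \<le> \<eta> * norm e" for e
  proof -
    have "\<bar>f e - inner h (E e)\<bar> = \<bar>inner (v - E' h) e\<bar>"
      by (simp add: v adj inner_diff_left)
    also have "\<dots> \<le> norm (v - E' h) * norm e"
      by (rule Cauchy_Schwarz_ineq2)
    also have "\<dots> \<le> \<eta> * norm e"
      using \<open>dist (E' h) v < \<eta>\<close> by (intro mult_right_mono) (auto simp: dist_norm norm_minus_commute)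
    finally show ?thesis .
  qed
  thus ?thesis by (rule that)
qed

lemma dim_inj_linear_image:
  fixes f :: "'a::real_vector \<Rightarrow> 'b::real_vector"
  assumes "linear f" and "inj f"
  shows "dim (f ` S) = dim S"
proof -
  obtain B where "B \<subseteq> S" and "independent B" and "S \<subseteq> span B" and "card B = dim S"
    using basis_exists[of S] by blast
  have "dim (f ` S) = card (f ` B)"
  proof (rule dim_unique)
    show "f ` B \<subseteq> f ` S" using \<open>B \<subseteq> S\<close> by blast
    show "f ` S \<subseteq> span (f ` B)"
      using \<open>S \<subseteq> span B\<close> span_linear_image[OF assms(1)] by blast
    show "independent (f ` B)"
      using linear_independent_injective_image[OF assms(1) \<open>independent B\<close>] assms(2)
      by (simp add: inj_on_subset)
  qed simp
  also have "\<dots> = dim S"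
    using \<open>card B = dim S\<close> assms(2) by (simp add: card_image inj_on_subset)
  finally show ?thesis .
qed

lemma fin_dim_if_inj_linear_image:
  fixes f :: "'a::real_vector \<Rightarrow> 'b::real_vector"
  assumes "linear f" and "inj f" and "subspace V" and "fin_dim (f ` V)"
  shows "fin_dim V"
proof -
  obtain B where "finite B" and span_B: "span B = f ` V"
    using assms(4) unfolding fin_dim_def by blast
  define B' where "B' = {x \<in> V. f x \<in> B}"
  have "finite B'"
    using \<open>finite B\<close> \<open>inj f\<close> unfolding B'_def
    by (auto intro: finite_subset[OF _ finite_vimageI])
  have "f ` B' = B"
    using span_B span_superset[of B] unfolding B'_def by auto
  have "span B' \<subseteq> V"
    using assms(3) by (intro span_minimal) (auto simp: B'_def)
  moreover have "V \<subseteq> span B'"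
  proof
    fix v
    assume "v \<in> V"
    hence "f v \<in> f ` span B'"
      using span_B span_linear_image[OF assms(1), of B'] \<open>f ` B' = B\<close> by auto
    thus "v \<in> span B'"
      using \<open>inj f\<close> by (auto simp: inj_image_mem_iff)
  qed
  ultimately show ?thesis
    unfolding fin_dim_def using \<open>finite B'\<close> by blast
qed

lemma has_vector_derivative_imp_eventually_lipschitz:
  fixes F :: "real \<Rightarrow> 'b::real_normed_vector"
  assumes "(F has_vector_derivative F') (at x within A)"
  obtains C where "\<forall>\<^sub>F l in at x within A. norm (F l - F x) \<le> C * \<bar>l - x\<bar>"
proof -
  have "((\<lambda>l. (1 / norm (l - x)) *\<^sub>R (F l - (F x + (l - x) *\<^sub>R F'))) \<longlongrightarrow> 0) (at x within A)"
    using assms by (simp add: has_vector_derivative_def has_derivative_within)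
  from tendstoD[OF this zero_less_one]
  have "\<forall>\<^sub>F l in at x within A. norm (F l - (F x + (l - x) *\<^sub>R F')) \<le> \<bar>l - x\<bar>"
  proof (rule eventually_mono)
    fix l
    let ?r = "F l - (F x + (l - x) *\<^sub>R F')"
    assume "dist ((1 / norm (l - x)) *\<^sub>R ?r) 0 < 1"
    hence "\<bar>1 / norm (l - x)\<bar> * norm ?r < 1"
      by (simp only: dist_norm diff_zero norm_scaleR)
    thus "norm ?r \<le> \<bar>l - x\<bar>"
      by (cases "l = x") (auto simp: field_simps)
  qed
  hence "\<forall>\<^sub>F l in at x within A. norm (F l - F x) \<le> (norm F' + 1) * \<bar>l - x\<bar>"
  proof (rule eventually_mono)
    fix l
    assume "norm (F l - (F x + (l - x) *\<^sub>R F')) \<le> \<bar>l - x\<bar>"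
    moreover have "norm (F l - F x) \<le> norm (F l - (F x + (l - x) *\<^sub>R F')) + norm ((l - x) *\<^sub>R F')"
      by (rule order_trans[OF _ norm_triangle_ineq]) (simp add: algebra_simps)
    moreover have "norm ((l - x) *\<^sub>R F') = \<bar>l - x\<bar> * norm F'"
      by (rule norm_scaleR)
    ultimately have "norm (F l - F x) \<le> \<bar>l - x\<bar> * norm F' + \<bar>l - x\<bar>"
      by linarith
    thus "norm (F l - F x) \<le> (norm F' + 1) * \<bar>l - x\<bar>"
      by (simp add: algebra_simps)
  qed
  thus ?thesis by (rule that)
qed

lemma has_real_derivative_zero_if_quadratic_bound:
  assumes "f x = 0" and "\<forall>\<^sub>F l in at x within J. \<bar>f l\<bar> \<le> C * (l - x)\<^sup>2"
  shows "(f has_real_derivative 0) (at x within J)"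
proof -
  have "\<forall>\<^sub>F l in at x within J. norm ((f l - f x) / (l - x)) \<le> C * \<bar>l - x\<bar>"
    using assms(2)
  proof (rule eventually_mono)
    fix l
    assume "\<bar>f l\<bar> \<le> C * (l - x)\<^sup>2"
    thus "norm ((f l - f x) / (l - x)) \<le> C * \<bar>l - x\<bar>"
      using assms(1) by (cases "l = x") (auto simp: abs_divide divide_le_eq power2_eq_square abs_mult_self_eq mult.assoc)
  qed
  moreover have "((\<lambda>l. C * \<bar>l - x\<bar>) \<longlongrightarrow> 0) (at x within J)"
    by (rule tendsto_eq_intros refl | simp)+
  ultimately have "((\<lambda>l. (f l - f x) / (l - x)) \<longlongrightarrow> 0) (at x within J)"
    by (rule Lim_null_comparison)
  thus ?thesis
    by (simp add: has_field_derivative_iff)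
qed

lemma strongly_smooth_on_imp_has_vector_derivative:
  assumes "strongly_smooth_on A T" and "t \<in> A"
  obtains T' where "((\<lambda>l. T l x) has_vector_derivative T') (at t within A)"
proof -
  obtain F where "F 0 = (\<lambda>l. T l x)"
    and "\<And>n. (F n has_vector_derivative F (Suc n) t) (at t within A)"
    using assms unfolding strongly_smooth_on_def smooth_on_def by blast
  thus ?thesis
    using that by metis
qed

section \<open>The Schur complement\<close>

lemma bounded_bilinear_frm: "bounded_bilinear (frm T l)"
proof -
  have "frm T l = (\<lambda>x y. blinfun_apply (T l x) (id y))"
    by (intro ext) (simp add: frm_def)
  thus ?thesis
    using bounded_bilinear.comp[OF bounded_bilinear_blinfun_apply
        blinfun.bounded_linear_right bounded_linear_ident] by simp
qed

lemmas frm_add_left = bounded_bilinear.add_left[OF bounded_bilinear_frm]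
  and frm_add_right = bounded_bilinear.add_right[OF bounded_bilinear_frm]
  and frm_diff_left = bounded_bilinear.diff_left[OF bounded_bilinear_frm]
  and frm_scaleR_left = bounded_bilinear.scaleR_left[OF bounded_bilinear_frm]
  and frm_zero_left = bounded_bilinear.zero_left[OF bounded_bilinear_frm]

lemma frm_zero_pair_left [simp]: "frm T l (0, 0) e = 0"
  using frm_zero_left[of T l e] by (simp add: zero_prod_def)

lemma frm_split_left: "frm T l (a, b) e = frm T l (a, 0) e + frm T l (0, b) e"
  using frm_add_left[of T l "(a, 0)" "(0, b)" e] by simp

lemma frm_split_right: "frm T l d (z, w) = frm T l d (z, 0) + frm T l d (0, w)"
  using frm_add_right[of T l d "(z, 0)" "(0, w)"] by simp

lemma abs_frm_le: "\<bar>frm T l x y\<bar> \<le> norm (T l x) * norm y"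
  unfolding frm_def using norm_blinfun[of "T l x" y] by simp

lemma abs_frm_le_norm: "\<bar>frm T l x y\<bar> \<le> norm (T l) * norm x * norm y"
  using abs_frm_le[of T l x y] norm_blinfun[of "T l" x]
  by (meson mult_right_mono norm_ge_zero order_trans)

locale negative_lower_block =
  fixes T :: "('d1::{real_inner,complete_space}, 'd2::{real_inner,complete_space}) opfun"
    and Z :: "real set"
    and \<epsilon> :: real
  assumes eps_pos: "0 < \<epsilon>"
    and lower_negative: "\<And>l y. l \<in> Z \<Longrightarrow> frm T l (0, y) (0, y) \<le> - \<epsilon> * (norm y)\<^sup>2"
begin

lemma lower_block_bound:
  assumes "l \<in> Z" and same_lower: "\<And>w. frm T l d (0, w) = frm T l (0, y) (0, w)"
  shows "\<epsilon> * norm y \<le> norm (T l d)"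
proof -
  have "\<epsilon> * norm y * norm y \<le> - frm T l (0, y) (0, y)"
    using lower_negative[OF assms(1), of y] by (simp add: power2_eq_square)
  also have "\<dots> \<le> norm (T l d) * norm y"
    using abs_frm_le[of T l d "(0, y)"] by (simp add: norm_Pair flip: same_lower)
  finally show ?thesis
    by (cases "y = 0") auto
qed

lemma lower_block_inj:
  assumes "l \<in> Z" and "\<And>w. frm T l (0, u) (0, w) = 0"
  shows "u = 0"
proof -
  have "\<epsilon> * norm u \<le> norm (T l 0)"
    by (rule lower_block_bound[OF assms(1)]) (simp add: assms(2) frm_zero_left)
  thus ?thesis using eps_pos by (simp add: mult_le_0_iff)
qed

lemma ex1_schur_sol:
  assumes "l \<in> Z"
  shows "\<exists>!y. \<forall>w. frm T l (0, y) (0, w) = frm T l (x, 0) (0, w)"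
proof (rule ex_ex1I)
  have pair: "bounded_linear (\<lambda>y::'d2. (0::'d1, y))"
    by (rule bounded_linear_Pair[OF bounded_linear_zero bounded_linear_ident])
  have "bounded_bilinear (\<lambda>y w. frm T l (0, y) (0, w))"
    by (rule bounded_bilinear.comp[OF bounded_bilinear_frm pair pair])
  moreover have "\<epsilon> * (norm y)\<^sup>2 \<le> \<bar>frm T l (0, y) (0, y)\<bar>" for y
    using lower_negative[OF assms, of y] by simp
  moreover have "bounded_linear (\<lambda>w. frm T l (x, 0) (0, w))"
    by (rule bounded_linear_compose[OF bounded_bilinear.bounded_linear_right[OF bounded_bilinear_frm] pair])
  ultimately obtain y where "\<And>w. frm T l (0, y) (0, w) = frm T l (x, 0) (0, w)"
    by (rule lax_milgram[OF _ eps_pos]) auto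
  thus "\<exists>y. \<forall>w. frm T l (0, y) (0, w) = frm T l (x, 0) (0, w)"
    by blast
next
  fix y y'
  assume "\<forall>w. frm T l (0, y) (0, w) = frm T l (x, 0) (0, w)"
    and "\<forall>w. frm T l (0, y') (0, w) = frm T l (x, 0) (0, w)"
  hence "frm T l (0, y - y') (0, w) = 0" for w
    using frm_diff_left[of T l "(0, y)" "(0, y')" "(0, w)"] by simp
  hence "y - y' = 0"
    by (rule lower_block_inj[OF assms])
  thus "y = y'" by simp
qed

lemma schur_sol_eq:
  assumes "l \<in> Z"
  shows "frm T l (0, schur_sol T l x) (0, w) = frm T l (x, 0) (0, w)"
  using theI'[OF ex1_schur_sol[OF assms, of x]] unfolding schur_sol_def by (rule spec)

lemma schur_sol_unique:
  assumes "l \<in> Z" and "\<And>w. frm T l (0, y) (0, w) = frm T l (x, 0) (0, w)"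
  shows "schur_sol T l x = y"
  unfolding schur_sol_def using assms(2) by (intro the1_equality[OF ex1_schur_sol[OF assms(1)]]) simp

lemma norm_schur_sol_le:
  assumes "l \<in> Z"
  shows "\<epsilon> * norm (schur_sol T l x) \<le> norm (T l) * norm x"
proof -
  have "\<epsilon> * norm (schur_sol T l x) \<le> norm (T l (x, 0))"
    using assms by (rule lower_block_bound) (simp add: schur_sol_eq[OF assms])
  also have "\<dots> \<le> norm (T l) * norm x"
    using norm_blinfun[of "T l" "(x, 0)"] by (simp add: norm_Pair)
  finally show ?thesis .
qed

lemma bounded_linear_schur_sol:
  assumes "l \<in> Z"
  shows "bounded_linear (schur_sol T l)"
proof (rule bounded_linear_intro)
  show "schur_sol T l (x + y) = schur_sol T l x + schur_sol T l y" for x y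
  proof (rule schur_sol_unique[OF assms])
    fix w
    have "frm T l (0, schur_sol T l x + schur_sol T l y) (0, w)
        = frm T l (0, schur_sol T l x) (0, w) + frm T l (0, schur_sol T l y) (0, w)"
      using frm_add_left[of T l "(0, schur_sol T l x)" "(0, schur_sol T l y)"] by simp
    also have "\<dots> = frm T l (x, 0) (0, w) + frm T l (y, 0) (0, w)"
      by (simp add: schur_sol_eq[OF assms])
    also have "\<dots> = frm T l (x + y, 0) (0, w)"
      using frm_add_left[of T l "(x, 0)" "(y, 0)"] by simp
    finally show "frm T l (0, schur_sol T l x + schur_sol T l y) (0, w) = frm T l (x + y, 0) (0, w)" .
  qed
  show "schur_sol T l (r *\<^sub>R x) = r *\<^sub>R schur_sol T l x" for r x
  proof (rule schur_sol_unique[OF assms])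
    fix w
    have "frm T l (0, r *\<^sub>R schur_sol T l x) (0, w) = r * frm T l (0, schur_sol T l x) (0, w)"
      using frm_scaleR_left[of T l r "(0, schur_sol T l x)"] by simp
    also have "\<dots> = frm T l (r *\<^sub>R x, 0) (0, w)"
      using frm_scaleR_left[of T l r "(x, 0)"] by (simp add: schur_sol_eq[OF assms])
    finally show "frm T l (0, r *\<^sub>R schur_sol T l x) (0, w) = frm T l (r *\<^sub>R x, 0) (0, w)" .
  qed
  show "norm (schur_sol T l x) \<le> norm x * (norm (T l) / \<epsilon>)" for x
    using norm_schur_sol_le[OF assms, of x] eps_pos by (simp add: field_simps)
qed

lemma schur_apply:
  assumes "l \<in> Z"
  shows "schur T l a z = frm T l (a, b) (z, 0) - frm T l (0, b + schur_sol T l a) (z, 0)"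
proof -
  define g where "g x z = frm T l (x, - schur_sol T l x) (z, 0)" for x z
  have "bounded_linear (\<lambda>x. (x, - schur_sol T l x))"
    using assms by (intro bounded_linear_Pair bounded_linear_ident bounded_linear_minus
        bounded_linear_schur_sol)
  hence "bounded_bilinear g"
    unfolding g_def
    by (rule bounded_bilinear.comp[OF bounded_bilinear_frm _
          bounded_linear_Pair[OF bounded_linear_ident bounded_linear_zero]])
  moreover have "schur T l = Blinfun (\<lambda>x. Blinfun (g x))"
    unfolding schur_def g_def
    using frm_diff_left[of T l "(_, 0)" "(0, schur_sol T l _)"] by simp
  moreover have "bounded_bilinear g \<Longrightarrow> Blinfun (g x) = bounded_bilinear.prod_right g x" for x
    by (intro blinfun_eqI) (simp add: bounded_linear_Blinfun_apply bounded_bilinear.bounded_linear_right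
        bounded_bilinear.prod_right.rep_eq)
  ultimately have "schur T l a z = g a z"
    by (simp add: bounded_linear_Blinfun_apply bounded_bilinear.bounded_linear_prod_right
        bounded_bilinear.prod_right.rep_eq)
  thus ?thesis
    unfolding g_def
    using frm_split_left[of T l a b "(z, 0)"] frm_diff_left[of T l "(a, 0)" "(0, schur_sol T l a)"]
      frm_add_left[of T l "(0, b)" "(0, schur_sol T l a)"] by simp
qed

lemma frm_lower_shift:
  assumes "l \<in> Z"
  shows "frm T l (0, b + schur_sol T l a) (0, w) = frm T l (a, b) (0, w)"
  using frm_add_left[of T l "(0, b)" "(0, schur_sol T l a)" "(0, w)"]
    frm_split_left[of T l a b "(0, w)"] by (simp add: schur_sol_eq[OF assms])

lemma frm_eq_zero_iff_schur:
  assumes "l \<in> Z"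
  shows "(\<forall>e. frm T l (a, b) e = 0) \<longleftrightarrow> schur T l a = 0 \<and> b = - schur_sol T l a"
proof
  assume zero: "\<forall>e. frm T l (a, b) e = 0"
  hence "b + schur_sol T l a = 0"
    by (intro lower_block_inj[OF assms]) (simp add: frm_lower_shift[OF assms])
  moreover from this have "schur T l a = 0"
    using zero by (intro blinfun_eqI) (simp add: schur_apply[OF assms, of a _ b])
  ultimately show "schur T l a = 0 \<and> b = - schur_sol T l a"
    by (simp add: eq_neg_iff_add_eq_0)
next
  assume "schur T l a = 0 \<and> b = - schur_sol T l a"
  hence "schur T l a = 0" and "b + schur_sol T l a = 0" by simp_all
  show "\<forall>e. frm T l (a, b) e = 0"
  proof
    fix e :: "'d1 \<times> 'd2"
    obtain z w where e: "e = (z, w)" by (cases e)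
    have "frm T l (a, b) (z, 0) = 0"
      using schur_apply[OF assms, of a z b] \<open>schur T l a = 0\<close> \<open>b + schur_sol T l a = 0\<close> by simp
    moreover have "frm T l (a, b) (0, w) = 0"
      using frm_lower_shift[OF assms, of b a w] \<open>b + schur_sol T l a = 0\<close> by simp
    ultimately show "frm T l (a, b) e = 0"
      using frm_split_right[of T l "(a, b)" z w] e by simp
  qed
qed

lemma lower_component_bound:
  assumes "l \<in> Z"
  shows "\<epsilon> * norm (b + schur_sol T l a) \<le> norm (T l (a, b))"
  using assms by (rule lower_block_bound) (simp add: frm_lower_shift[OF assms])

lemma norm_schur_le:
  assumes "l \<in> Z"
  shows "norm (schur T l a) \<le> norm (T l (a, b)) + norm (T l) * norm (b + schur_sol T l a)"
proof (rule norm_blinfun_bound)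
  fix z
  have "\<bar>schur T l a z\<bar> \<le> \<bar>frm T l (a, b) (z, 0)\<bar> + \<bar>frm T l (0, b + schur_sol T l a) (z, 0)\<bar>"
    using schur_apply[OF assms, of a z b] by linarith
  also have "\<dots> \<le> norm (T l (a, b)) * norm z + norm (T l) * norm (b + schur_sol T l a) * norm z"
    using abs_frm_le[of T l "(a, b)" "(z, 0)"] abs_frm_le_norm[of T l "(0, b + schur_sol T l a)" "(z, 0)"]
    by (simp add: norm_Pair)
  finally show "norm (schur T l a z) \<le> (norm (T l (a, b)) + norm (T l) * norm (b + schur_sol T l a)) * norm z"
    by (simp add: algebra_simps)
qed simp

lemma bounded_below_if_schur_bounded_below:
  assumes "l \<in> Z" and "0 < c" and schur_below: "\<And>a. c * norm a \<le> norm (schur T l a)"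
  obtains c' where "0 < c'" and "\<And>d. c' * norm d \<le> norm (T l d)"
proof -
  define K where "K = norm (T l) / \<epsilon>"
  define M where "M = (1 + K) * (1 + K) / c + 1 / \<epsilon>"
  have "0 \<le> K" and "0 < M"
    unfolding K_def M_def using eps_pos \<open>0 < c\<close> by (auto intro: add_nonneg_pos)
  have "norm d \<le> M * norm (T l d)" for d
  proof -
    obtain a b where d: "d = (a, b)" by (cases d)
    define N where "N = norm (T l d)"
    define u where "u = b + schur_sol T l a"
    have u_le: "norm u \<le> N / \<epsilon>"
      using lower_component_bound[OF assms(1), of b a] eps_pos by (simp add: u_def N_def d field_simps)
    have "c * norm a \<le> N + \<epsilon> * K * norm u"
      using schur_below[of a] norm_schur_le[OF assms(1), of a b] eps_pos
      by (simp add: u_def N_def d K_def)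
    also have "\<dots> \<le> N * (1 + K)"
      using u_le \<open>0 \<le> K\<close> eps_pos by (simp add: algebra_simps field_simps mult_left_mono)
    finally have a_le: "norm a \<le> N * (1 + K) / c"
      using \<open>0 < c\<close> by (simp add: field_simps)
    have "norm (schur_sol T l a) \<le> K * norm a"
      using norm_schur_sol_le[OF assms(1), of a] eps_pos by (simp add: K_def field_simps)
    hence "norm d \<le> (1 + K) * norm a + N / \<epsilon>"
      using norm_Pair_le[of a b] norm_triangle_ineq4[of u "schur_sol T l a"] u_le
      by (simp add: d u_def algebra_simps)
    also have "\<dots> \<le> M * N"
      using a_le \<open>0 \<le> K\<close> \<open>0 < c\<close> mult_left_mono[OF a_le, of "1 + K"]
      by (simp add: M_def field_simps)
    finally show ?thesis by (simp add: N_def)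
  qed
  hence "1 / M * norm d \<le> norm (T l d)" for d
    using \<open>0 < M\<close> by (simp add: field_simps)
  with \<open>0 < M\<close> show ?thesis
    by (intro that[of "1 / M"]) auto
qed

lemma schur_surj_if_surj:
  assumes "l \<in> Z" and "surj (T l)"
  shows "surj (schur T l)"
proof -
  have "g \<in> range (schur T l)" for g
  proof -
    have "bounded_linear (\<lambda>e::'d1 \<times> 'd2. g (fst e))"
      by (rule bounded_linear_compose[OF blinfun.bounded_linear_right bounded_linear_fst])
    then obtain a b where ab: "T l (a, b) = Blinfun (\<lambda>e. g (fst e))"
      using \<open>surj (T l)\<close> by (metis surj_pair surjD)
    hence frm_ab: "frm T l (a, b) e = g (fst e)" for e
      using \<open>bounded_linear _\<close> by (simp add: frm_def bounded_linear_Blinfun_apply)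
    hence "b + schur_sol T l a = 0"
      by (intro lower_block_inj[OF assms(1)]) (simp add: frm_lower_shift[OF assms(1)] blinfun.zero_right)
    hence "schur T l a = g"
      by (intro blinfun_eqI) (simp add: schur_apply[OF assms(1), of a _ b] frm_ab)
    thus ?thesis by blast
  qed
  thus ?thesis by blast
qed

text \<open>The Schur form and the quadratic form of the lifted vector agree up to the square of
  the defect of the lift: with \<open>u\<close> the difference of the two lifts, both the defect of the
  Schur form and the lower block of the defect equal pairings with \<open>(0, u)\<close>.\<close>

lemma schur_form_close_to_lift:
  fixes y :: 'd1
  assumes "l \<in> Z" and "\<mu> \<in> Z" and sym: "\<And>d e. frm T l d e = frm T l e d"
  defines "d \<equiv> (y, - schur_sol T \<mu> y)"
  shows "\<epsilon> * \<bar>schur T l y y - frm T l d d\<bar> \<le> (norm (T l d))\<^sup>2"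
proof -
  define e where "e = (y, - schur_sol T l y)"
  define u where "u = schur_sol T \<mu> y - schur_sol T l y"
  have e_lower: "frm T l e (0, w) = 0" for w
    using frm_lower_shift[OF assms(1), of "- schur_sol T l y" y w] by (simp add: e_def)
  have "schur T l y y = frm T l e d"
    using schur_apply[OF assms(1), of y y "- schur_sol T l y"] e_lower
      frm_split_right[of T l e y "- schur_sol T \<mu> y"] by (simp add: e_def d_def)
  moreover have "e - d = (0, u)"
    by (simp add: e_def d_def u_def)
  ultimately have defect: "schur T l y y - frm T l d d = frm T l d (0, u)"
    using frm_diff_left[of T l e d d] sym by metis
  have "frm T l d (0, w) = frm T l (0, - u) (0, w)" for w
    using frm_diff_left[of T l e d "(0, w)"] \<open>e - d = (0, u)\<close> e_lower
      frm_diff_left[of T l 0 "(0, u)" "(0, w)"] by (simp add: frm_zero_left)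
  hence "\<epsilon> * norm (- u) \<le> norm (T l d)"
    by (rule lower_block_bound[OF assms(1)])
  hence "\<epsilon> * norm u \<le> norm (T l d)"
    by simp
  have "\<epsilon> * \<bar>frm T l d (0, u)\<bar> \<le> \<epsilon> * (norm (T l d) * norm u)"
    using abs_frm_le[of T l d "(0, u)"] eps_pos by (simp add: norm_Pair)
  also have "\<dots> \<le> norm (T l d) * norm (T l d)"
    using mult_left_mono[OF \<open>\<epsilon> * norm u \<le> norm (T l d)\<close> norm_ge_zero[of "T l d"]]
    by (simp add: mult_ac)
  finally have "\<epsilon> * \<bar>frm T l d (0, u)\<bar> \<le> norm (T l d) * norm (T l d)" .
  thus ?thesis
    by (simp add: defect power2_eq_square)
qed

lemma schur_form_has_derivative:
  fixes y :: 'd1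
  assumes "J \<subseteq> Z" and "\<mu> \<in> J" and "\<mu> \<in> Z" and "0 < \<delta>"
    and sym: "\<And>l d e. l \<in> Z \<Longrightarrow> l \<noteq> \<mu> \<Longrightarrow> \<bar>l - \<mu>\<bar> < \<delta> \<Longrightarrow> frm T l d e = frm T l e d"
    and "schur T \<mu> y = 0"
  defines "d \<equiv> (y, - schur_sol T \<mu> y)"
  assumes "((\<lambda>l. T l d) has_vector_derivative T') (at \<mu> within Z)"
    and "((\<lambda>l. frm T l d d) has_real_derivative D) (at \<mu> within J)"
  shows "((\<lambda>l. schur T l y y) has_real_derivative D) (at \<mu> within J)"
proof -
  have "\<forall>e. frm T \<mu> d e = 0"
    using frm_eq_zero_iff_schur[OF assms(3), of y "- schur_sol T \<mu> y"] \<open>schur T \<mu> y = 0\<close>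
    by (simp add: d_def)
  hence "T \<mu> d = 0"
    unfolding frm_def by (intro blinfun_eqI) (simp del: split_paired_All)
  obtain C where "\<forall>\<^sub>F l in at \<mu> within Z. norm (T l d - T \<mu> d) \<le> C * \<bar>l - \<mu>\<bar>"
    using has_vector_derivative_imp_eventually_lipschitz[OF assms(8)] by blast
  hence "\<forall>\<^sub>F l in at \<mu> within J. norm (T l d) \<le> C * \<bar>l - \<mu>\<bar>"
    using filter_leD[OF at_le[OF assms(1)]] \<open>T \<mu> d = 0\<close> by simp
  moreover have "\<forall>\<^sub>F l in at \<mu> within J. l \<in> Z \<and> l \<noteq> \<mu> \<and> \<bar>l - \<mu>\<bar> < \<delta>"
    unfolding eventually_at using \<open>0 < \<delta>\<close> assms(1)
    by (intro exI[of _ \<delta>]) (auto simp: dist_real_def)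
  ultimately have "\<forall>\<^sub>F l in at \<mu> within J.
      \<bar>schur T l y y - frm T l d d\<bar> \<le> C\<^sup>2 / \<epsilon> * (l - \<mu>)\<^sup>2"
  proof eventually_elim
    case (elim l)
    hence "\<epsilon> * \<bar>schur T l y y - frm T l d d\<bar> \<le> (norm (T l d))\<^sup>2"
      using schur_form_close_to_lift[OF _ assms(3) sym] by (simp add: d_def)
    also have "\<dots> \<le> (C * \<bar>l - \<mu>\<bar>)\<^sup>2"
      using elim by (intro power_mono) auto
    finally show ?case
      using eps_pos by (simp add: field_simps power_mult_distrib)
  qed
  moreover have "schur T \<mu> y y - frm T \<mu> d d = 0"
    using \<open>schur T \<mu> y = 0\<close> \<open>T \<mu> d = 0\<close> by (simp add: frm_def)
  ultimately have "((\<lambda>l. schur T l y y - frm T l d d) has_real_derivative 0) (at \<mu> within J)"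
    by (intro has_real_derivative_zero_if_quadratic_bound)
  from DERIV_add[OF assms(9) this] show ?thesis
    by simp
qed

end

section \<open>The operator \<open>[T(\<lambda>)]\<^sup>\<bullet>\<close>\<close>

lemma bounded_linear_embI: "bounded_linear (embI I1 I2)"
proof -
  have "embI I1 I2 = (\<lambda>d. (I1 (fst d), I2 (snd d)))"
    by (intro ext) (simp add: embI_def)
  thus ?thesis
    by (simp add: bounded_linear_Pair bounded_linear_compose[OF blinfun.bounded_linear_right]
        bounded_linear_fst bounded_linear_snd)
qed

locale negative_lower_block_embedded = negative_lower_block T Z \<epsilon>
  for T :: "('d1::{real_inner,complete_space}, 'd2::{real_inner,complete_space}) opfun"
    and Z \<epsilon> +
  fixes I1 :: "'d1 \<Rightarrow>\<^sub>L 'h1::{real_inner,complete_space}"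
    and I2 :: "'d2 \<Rightarrow>\<^sub>L 'h2::{real_inner,complete_space}"
  assumes inj_I1: "inj (blinfun_apply I1)" and dense_I1: "closure (range (blinfun_apply I1)) = UNIV"
    and inj_I2: "inj (blinfun_apply I2)" and dense_I2: "closure (range (blinfun_apply I2)) = UNIV"
begin

abbreviation "E \<equiv> embI I1 I2"

definition representable :: "real \<Rightarrow> 'd1 \<times> 'd2 \<Rightarrow> bool" where
  "representable l d \<longleftrightarrow> (\<exists>h. \<forall>e. frm T l d e = inner h (E e))"

lemma inj_embI: "inj E"
  using inj_I1 inj_I2 by (auto simp: inj_def embI_def prod_eq_iff)

lemma dense_embI: "closure (range E) = UNIV"
proof -
  have "range E = range I1 \<times> range I2"
    by (auto simp: embI_def image_def)
  thus ?thesis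
    by (simp add: closure_Times dense_I1 dense_I2)
qed

lemma bul_embI:
  assumes "\<And>e. frm T l d e = inner h (E e)"
  shows "bul T I1 I2 l (E d) = h"
  unfolding bul_def inv_f_f[OF inj_embI]
proof (rule the_equality)
  fix h'
  assume h': "\<forall>e. frm T l d e = inner h' (E e)"
  have "inner (h' - h) (E e) = 0" for e
    using assms[of e] h'[rule_format, of e] by (simp add: inner_diff_left)
  hence "h' - h = 0"
    by (rule orthogonal_dense_range_eq_zero[OF dense_embI])
  thus "h' = h" by simp
qed (use assms in blast)

lemma mem_bul_dom_iff: "x \<in> bul_dom T I1 I2 l \<longleftrightarrow> (\<exists>d. x = E d \<and> representable l d)"
  unfolding bul_dom_def representable_def by simp

lemma embI_mem_bul_dom_iff: "E d \<in> bul_dom T I1 I2 l \<longleftrightarrow> representable l d"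
  unfolding mem_bul_dom_iff using inj_embI by (metis injD)

lemma inner_bul_embI_eq_frm:
  assumes "representable l d"
  shows "inner (bul T I1 I2 l (E d)) (E d) = frm T l d d"
proof -
  obtain h where h: "\<And>e. frm T l d e = inner h (E e)"
    using assms unfolding representable_def by blast
  thus ?thesis
    using bul_embI[OF h] by simp
qed

lemma mem_bul_ker_iff: "x \<in> bul_ker T I1 I2 l \<longleftrightarrow> (\<exists>d. x = E d \<and> (\<forall>e. frm T l d e = 0))"
proof
  assume "x \<in> bul_ker T I1 I2 l"
  then obtain d h where "x = E d" and h: "\<And>e. frm T l d e = inner h (E e)"
    and "bul T I1 I2 l x = 0"
    unfolding bul_ker_def mem_bul_dom_iff representable_def by blast
  moreover from this have "h = 0"
    using bul_embI[OF h] by simp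
  with h have "\<forall>e. frm T l d e = 0"
    by simp
  ultimately show "\<exists>d. x = E d \<and> (\<forall>e. frm T l d e = 0)"
    by blast
next
  assume "\<exists>d. x = E d \<and> (\<forall>e. frm T l d e = 0)"
  then obtain d where "x = E d" and zero: "\<And>e. frm T l d e = inner 0 (E e)"
    by auto
  thus "x \<in> bul_ker T I1 I2 l"
    unfolding bul_ker_def mem_bul_dom_iff representable_def using bul_embI[OF zero] by blast
qed

context
  fixes l :: real
  assumes resolvent: "zero_in_resolvent (bul_dom T I1 I2 l) (bul T I1 I2 l)"
begin

lemma resolvent_inj:
  assumes "\<forall>e. frm T l d e = 0"
  shows "d = 0"
proof -
  obtain R :: "('h1 \<times> 'h2) \<Rightarrow>\<^sub>L ('h1 \<times> 'h2)"
    where R: "\<And>x. x \<in> bul_dom T I1 I2 l \<Longrightarrow> R (bul T I1 I2 l x) = x"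
    using resolvent unfolding zero_in_resolvent_def by blast
  have "E d \<in> bul_ker T I1 I2 l"
    using assms mem_bul_ker_iff by blast
  hence "E d \<in> bul_dom T I1 I2 l" and "bul T I1 I2 l (E d) = 0"
    unfolding bul_ker_def by auto
  hence "E d = R 0"
    using R by metis
  hence "E d = E 0"
    using linear_0[OF bounded_linear.linear[OF bounded_linear_embI]] by simp
  thus ?thesis
    by (rule injD[OF inj_embI])
qed

lemma resolvent_representable:
  obtains d where "\<And>e. frm T l d e = inner h (E e)"
proof -
  obtain R :: "('h1 \<times> 'h2) \<Rightarrow>\<^sub>L ('h1 \<times> 'h2)"
    where "R h \<in> bul_dom T I1 I2 l" and "bul T I1 I2 l (R h) = h"
    using resolvent unfolding zero_in_resolvent_def by blast
  moreover from this(1) obtain d where "R h = E d" and "representable l d"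
    unfolding mem_bul_dom_iff by blast
  moreover from this(2) obtain h' where h': "\<And>e. frm T l d e = inner h' (E e)"
    unfolding representable_def by blast
  ultimately have "h' = h"
    using bul_embI[OF h'] by simp
  with h' have "\<And>e. frm T l d e = inner h (E e)"
    by simp
  thus ?thesis by (rule that)
qed

lemma resolvent_range_dense:
  assumes "0 < \<eta>"
  obtains d where "representable l d" and "norm (T l d - f) \<le> \<eta>"
proof -
  obtain h where h: "\<And>e. \<bar>f e - inner h (E e)\<bar> \<le> \<eta> * norm e"
    using adjoint_range_dense_in_dual[OF bounded_linear_embI inj_embI blinfun.bounded_linear_right assms]
    by blast
  obtain d where d: "\<And>e. frm T l d e = inner h (E e)"
    by (rule resolvent_representable[of h]) blast
  have "norm (T l d - f) \<le> \<eta>"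
  proof (rule norm_blinfun_bound)
    show "norm ((T l d - f) e) \<le> \<eta> * norm e" for e
      using h[of e] d[of e] by (simp add: frm_def minus_blinfun.rep_eq abs_minus_commute)
  qed (use assms in simp)
  moreover have "representable l d"
    unfolding representable_def using d by blast
  ultimately show ?thesis
    using that by blast
qed

context
  assumes "l \<in> Z"
    and decomposition: "\<exists>P K. schur T l = P + K \<and> uniformly_positive P \<and> compact_operator K"
begin

lemma schur_bounded_below_if_resolvent:
  obtains c where "0 < c" and "\<And>a. c * norm a \<le> norm (schur T l a)"
proof -
  obtain P K where "schur T l = P + K" and "uniformly_positive P" and "compact_operator K"
    using decomposition by blast
  moreover have "a = 0" if "schur T l a = 0" for a
  proof -
    have "\<forall>e. frm T l (a, - schur_sol T l a) e = 0"
      using frm_eq_zero_iff_schur[OF \<open>l \<in> Z\<close>] that by simp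
    hence "(a, - schur_sol T l a) = 0"
      by (rule resolvent_inj)
    thus "a = 0"
      by (simp add: zero_prod_def)
  qed
  ultimately show ?thesis
    using bounded_below_if_inj_compact_perturbation that by metis
qed

lemma bounded_below_if_resolvent:
  obtains c where "0 < c" and "\<And>d. c * norm d \<le> norm (T l d)"
  using schur_bounded_below_if_resolvent bounded_below_if_schur_bounded_below[OF \<open>l \<in> Z\<close>]
  by metis

lemma surj_if_resolvent: "surj (T l)"
proof -
  obtain c where "0 < c" and "\<And>d. c * norm d \<le> norm (T l d)"
    by (rule bounded_below_if_resolvent) auto
  hence closed: "closed (range (T l))"
    by (intro closed_range_if_bounded_below[OF blinfun.bounded_linear_right])
  have "f \<in> range (T l)" for f
  proof (rule iffD1[OF closed_approachable[OF closed]], intro allI impI)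
    fix \<eta> :: real
    assume "0 < \<eta>"
    hence "0 < \<eta> / 2" by simp
    then obtain d where "representable l d" and "norm (T l d - f) \<le> \<eta> / 2"
      by (rule resolvent_range_dense)
    thus "\<exists>y\<in>range (T l). dist y f < \<eta>"
      using \<open>0 < \<eta>\<close> by (intro bexI[of _ "T l d"]) (auto simp: dist_norm)
  qed
  thus ?thesis by blast
qed

lemma schur_bounded_invertible_if_resolvent: "bounded_invertible (schur T l)"
  using schur_bounded_below_if_resolvent bounded_invertible_if_bounded_below_surj
    schur_surj_if_surj[OF \<open>l \<in> Z\<close> surj_if_resolvent] by metis

lemma representable_sequence:
  obtains s where "\<And>n. representable l (s n)" and "s \<longlonglongrightarrow> d"
proof -
  obtain c where "0 < c" and below: "\<And>d. c * norm d \<le> norm (T l d)"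
    by (rule bounded_below_if_resolvent) auto
  have "\<exists>d'. representable l d' \<and> norm (d' - d) \<le> 1 / real (Suc n) / c" for n
  proof -
    obtain d' where "representable l d'" and close: "norm (T l d' - T l d) \<le> 1 / real (Suc n)"
      using resolvent_range_dense[of "1 / real (Suc n)" "T l d"] by auto
    moreover have "norm (d' - d) * c \<le> 1 / real (Suc n)"
      using below[of "d' - d"] close by (simp add: blinfun.diff_right mult.commute)
    ultimately show ?thesis
      using \<open>0 < c\<close> by (intro exI[of _ d']) (simp add: pos_le_divide_eq mult_ac)
  qed
  then obtain s where s: "\<And>n. representable l (s n)"
    and close: "\<And>n. norm (s n - d) \<le> 1 / real (Suc n) / c"
    by metis
  have "(\<lambda>n. 1 / real (Suc n) / c) \<longlonglongrightarrow> 0"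
    using tendsto_divide[OF LIMSEQ_inverse_real_of_nat tendsto_const, of c] \<open>0 < c\<close>
    by (simp add: inverse_eq_divide)
  hence "(\<lambda>n. s n - d) \<longlonglongrightarrow> 0"
    by (rule Lim_null_comparison[rotated]) (intro always_eventually allI close)
  hence "s \<longlonglongrightarrow> d"
    by (simp add: LIM_zero_iff)
  with s show ?thesis by (rule that)
qed

lemma frm_sym_if_resolvent:
  assumes "selfadjoint_op (bul_dom T I1 I2 l) (bul T I1 I2 l)"
  shows "frm T l d e = frm T l e d"
proof -
  have sym: "frm T l d e = frm T l e d" if "representable l d" and "representable l e" for d e
  proof -
    obtain h where h: "\<And>x. frm T l d x = inner h (E x)"
      using \<open>representable l d\<close> unfolding representable_def by blast
    obtain k where k: "\<And>x. frm T l e x = inner k (E x)"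
      using \<open>representable l e\<close> unfolding representable_def by blast
    have "E d \<in> bul_dom T I1 I2 l" and "E e \<in> bul_dom T I1 I2 l"
      unfolding mem_bul_dom_iff using that by blast+
    hence "inner (bul T I1 I2 l (E d)) (E e) = inner (E d) (bul T I1 I2 l (E e))"
      using assms unfolding selfadjoint_op_def by blast
    thus ?thesis
      by (simp add: h k bul_embI[OF h] bul_embI[OF k] inner_commute)
  qed
  obtain s where s: "\<And>n. representable l (s n)" and "s \<longlonglongrightarrow> d"
    by (rule representable_sequence) auto
  obtain t where t: "\<And>n. representable l (t n)" and "t \<longlonglongrightarrow> e"
    by (rule representable_sequence) auto
  have "(\<lambda>n. frm T l (s n) (t n)) \<longlonglongrightarrow> frm T l d e"
    and "(\<lambda>n. frm T l (t n) (s n)) \<longlonglongrightarrow> frm T l e d"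
    using bounded_bilinear.tendsto[OF bounded_bilinear_frm] \<open>s \<longlonglongrightarrow> d\<close> \<open>t \<longlonglongrightarrow> e\<close> by blast+
  thus ?thesis
    using sym[OF s t] LIMSEQ_unique by simp
qed

end

end

lemma linear_lift:
  assumes "\<mu> \<in> Z"
  shows "linear (\<lambda>x. E (x, - schur_sol T \<mu> x))"
  using assms by (intro bounded_linear.linear bounded_linear_compose[OF bounded_linear_embI]
      bounded_linear_Pair bounded_linear_ident bounded_linear_minus bounded_linear_schur_sol)

lemma inj_lift: "inj (\<lambda>x. E (x, - schur_sol T \<mu> x))"
  using inj_embI by (auto simp: inj_def)

lemma lift_nonzero:
  assumes "y \<noteq> 0"
  shows "E (y, - schur_sol T \<mu> y) \<noteq> 0"
proof
  assume "E (y, - schur_sol T \<mu> y) = 0"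
  hence "E (y, - schur_sol T \<mu> y) = E 0"
    using linear_0[OF bounded_linear.linear[OF bounded_linear_embI]] by simp
  hence "(y, - schur_sol T \<mu> y) = 0"
    by (rule injD[OF inj_embI])
  thus False
    using assms by (simp add: zero_prod_def)
qed

lemma lift_schur_ker_eq_bul_ker:
  assumes "\<mu> \<in> Z"
  shows "(\<lambda>x. E (x, - schur_sol T \<mu> x)) ` op_ker (schur T \<mu>) = bul_ker T I1 I2 \<mu>"
proof (intro set_eqI iffI)
  fix x
  assume "x \<in> (\<lambda>x. E (x, - schur_sol T \<mu> x)) ` op_ker (schur T \<mu>)"
  then obtain a where "schur T \<mu> a = 0" and "x = E (a, - schur_sol T \<mu> a)"
    unfolding op_ker_def by blast
  thus "x \<in> bul_ker T I1 I2 \<mu>"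
    unfolding mem_bul_ker_iff using frm_eq_zero_iff_schur[OF assms, of a "- schur_sol T \<mu> a"] by blast
next
  fix x
  assume "x \<in> bul_ker T I1 I2 \<mu>"
  then obtain a b where "x = E (a, b)" and "\<forall>e. frm T \<mu> (a, b) e = 0"
    unfolding mem_bul_ker_iff by (metis surj_pair)
  hence "schur T \<mu> a = 0" and "b = - schur_sol T \<mu> a"
    using frm_eq_zero_iff_schur[OF assms] by blast+
  hence "schur T \<mu> a = 0" and "x = E (a, - schur_sol T \<mu> a)"
    using \<open>x = E (a, b)\<close> by simp_all
  thus "x \<in> (\<lambda>x. E (x, - schur_sol T \<mu> x)) ` op_ker (schur T \<mu>)"
    unfolding op_ker_def by blast
qed

lemma fin_dim_schur_ker:
  assumes "\<mu> \<in> Z" and "fin_dim (bul_ker T I1 I2 \<mu>)"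
  shows "fin_dim (op_ker (schur T \<mu>))"
    and "dim (op_ker (schur T \<mu>)) = dim (bul_ker T I1 I2 \<mu>)"
proof -
  have "subspace (op_ker (schur T \<mu>))"
    unfolding op_ker_def
    by (rule linear_subspace_kernel[OF bounded_linear.linear[OF blinfun.bounded_linear_right]])
  thus "fin_dim (op_ker (schur T \<mu>))"
    using fin_dim_if_inj_linear_image[OF linear_lift[OF assms(1)] inj_lift]
      lift_schur_ker_eq_bul_ker[OF assms(1)] assms(2) by simp
  show "dim (op_ker (schur T \<mu>)) = dim (bul_ker T I1 I2 \<mu>)"
    using dim_inj_linear_image[OF linear_lift[OF assms(1)] inj_lift, of "op_ker (schur T \<mu>)"]
    unfolding lift_schur_ker_eq_bul_ker[OF assms(1)] by simp
qed

lemma schur_ker_nontrivial: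
  assumes "\<mu> \<in> Z" and "bul_ker T I1 I2 \<mu> \<noteq> {0}"
  shows "op_ker (schur T \<mu>) \<noteq> {0}"
proof
  assume "op_ker (schur T \<mu>) = {0}"
  hence "bul_ker T I1 I2 \<mu> = {E (0, - schur_sol T \<mu> 0)}"
    using lift_schur_ker_eq_bul_ker[OF assms(1)] by simp
  also have "\<dots> = {0}"
    using linear_0[OF linear_lift[OF assms(1)]] by simp
  finally show False
    using assms(2) by contradiction
qed

context
  fixes zm zp \<mu> \<delta> :: real
  assumes Z_eq: "Z = {zm..zp}" and "\<mu> \<in> Z" and "0 < \<delta>"
    and resolvent_near: "\<And>l. l \<in> Z \<Longrightarrow> l \<noteq> \<mu> \<Longrightarrow> \<bar>l - \<mu>\<bar> < \<delta> \<Longrightarrow>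
        zero_in_resolvent (bul_dom T I1 I2 l) (bul T I1 I2 l)"
    and decomposition: "\<forall>l\<in>Z. \<exists>P K. schur T l = P + K \<and> uniformly_positive P \<and> compact_operator K"
begin

lemma schur_isolated_eigenvalue:
  assumes "bul_ker T I1 I2 \<mu> \<noteq> {0}"
  shows "op_isolated_eigenvalue zm zp (schur T) \<mu>"
  unfolding op_isolated_eigenvalue_def
  using schur_ker_nontrivial[OF \<open>\<mu> \<in> Z\<close> assms] \<open>0 < \<delta>\<close>
    schur_bounded_invertible_if_resolvent[OF resolvent_near] decomposition Z_eq by blast

lemma schur_negative_type:
  assumes "\<forall>l\<in>Z. selfadjoint_op (bul_dom T I1 I2 l) (bul T I1 I2 l)"
    and "strongly_smooth_on Z T"
    and "bul_negative_type zm zp T I1 I2 \<mu>"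
  shows "op_negative_type zm zp (schur T) \<mu>"
  unfolding op_negative_type_def
proof (intro ballI impI)
  fix y
  assume "y \<in> op_ker (schur T \<mu>)" and "y \<noteq> 0"
  define d where "d = (y, - schur_sol T \<mu> y)"
  have "E d \<in> bul_ker T I1 I2 \<mu>"
    using lift_schur_ker_eq_bul_ker[OF \<open>\<mu> \<in> Z\<close>] \<open>y \<in> op_ker _\<close> unfolding d_def by blast
  moreover have "E d \<noteq> 0"
    unfolding d_def using \<open>y \<noteq> 0\<close> by (rule lift_nonzero)
  ultimately have "\<exists>J. is_interval J \<and> \<mu> \<in> J \<and> J \<subseteq> Z \<and> J \<noteq> {\<mu>} \<and>
      (\<forall>l\<in>J. E d \<in> bul_dom T I1 I2 l) \<and>
      (\<exists>D<0. ((\<lambda>l. inner (bul T I1 I2 l (E d)) (E d)) has_real_derivative D) (at \<mu> within J))"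
    using assms(3) unfolding bul_negative_type_def Z_eq by blast
  then obtain J D where J: "is_interval J" "\<mu> \<in> J" "J \<subseteq> Z" "J \<noteq> {\<mu>}"
    and dom: "\<forall>l\<in>J. E d \<in> bul_dom T I1 I2 l" and "D < 0"
    and deriv: "((\<lambda>l. inner (bul T I1 I2 l (E d)) (E d)) has_real_derivative D) (at \<mu> within J)"
    by auto
  have "inner (bul T I1 I2 l (E d)) (E d) = frm T l d d" if "l \<in> J" for l
    using dom that by (simp add: embI_mem_bul_dom_iff inner_bul_embI_eq_frm)
  hence frm_deriv: "((\<lambda>l. frm T l d d) has_real_derivative D) (at \<mu> within J)"
    by (rule has_field_derivative_transform_within[OF deriv zero_less_one \<open>\<mu> \<in> J\<close>])
  obtain T' where T_deriv: "((\<lambda>l. T l d) has_vector_derivative T') (at \<mu> within Z)"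
    by (rule strongly_smooth_on_imp_has_vector_derivative[OF assms(2) \<open>\<mu> \<in> Z\<close>])
  have sym: "frm T l a b = frm T l b a" if "l \<in> Z" "l \<noteq> \<mu>" "\<bar>l - \<mu>\<bar> < \<delta>" for l a b
    by (rule frm_sym_if_resolvent[OF resolvent_near[OF that] \<open>l \<in> Z\<close>])
      (use decomposition assms(1) \<open>l \<in> Z\<close> in auto)
  have "schur T \<mu> y = 0"
    using \<open>y \<in> op_ker _\<close> unfolding op_ker_def by simp
  from schur_form_has_derivative[OF \<open>J \<subseteq> Z\<close> \<open>\<mu> \<in> J\<close> \<open>\<mu> \<in> Z\<close> \<open>0 < \<delta>\<close> sym this
      T_deriv[unfolded d_def] frm_deriv[unfolded d_def]]
  have "((\<lambda>l. schur T l y y) has_real_derivative D) (at \<mu> within J)" .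
  thus "\<exists>J. is_interval J \<and> \<mu> \<in> J \<and> J \<subseteq> {zm..zp} \<and> J \<noteq> {\<mu>} \<and>
      (\<exists>d<0. ((\<lambda>l. schur T l y y) has_real_derivative d) (at \<mu> within J))"
    using J \<open>D < 0\<close> Z_eq by blast
qed

end

end

theorem mainTheorem15:
  fixes zm zp :: real
    and I1 :: "'d1::{real_inner,complete_space} \<Rightarrow>\<^sub>L 'h1::{real_inner,complete_space}"
    and I2 :: "'d2::{real_inner,complete_space} \<Rightarrow>\<^sub>L 'h2::{real_inner,complete_space}"
    and T :: "('d1,'d2) opfun"
    and mu :: real
  assumes "zm < zp"
    and "inj (blinfun_apply I1)" and "closure (range (blinfun_apply I1)) = UNIV"
    and "inj (blinfun_apply I2)" and "closure (range (blinfun_apply I2)) = UNIV"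
    and "strongly_smooth_on {zm..zp} T"
    and "\<forall>l\<in>{zm..zp}. selfadjoint_op (bul_dom T I1 I2 l) (bul T I1 I2 l)"
    and "\<exists>\<epsilon>>0. \<forall>l\<in>{zm..zp}. \<forall>y. frm T l (0, y) (0, y) \<le> - \<epsilon> * (norm y)\<^sup>2"
    and "continuous_on {zm..zp} (schur T)"
    and "\<forall>l\<in>{zm..zp}. \<exists>P K. schur T l = P + K \<and> uniformly_positive P \<and> compact_operator K"
    and "mu \<in> {zm<..<zp}"
    and "bul_isolated_eigenvalue zm zp T I1 I2 mu"
    and "fin_dim (bul_ker T I1 I2 mu)"
    and "bul_negative_type zm zp T I1 I2 mu"
  shows "op_isolated_eigenvalue zm zp (schur T) mu \<and> op_negative_type zm zp (schur T) mu
         \<and> fin_dim (op_ker (schur T mu)) \<and> dim (op_ker (schur T mu)) = dim (bul_ker T I1 I2 mu)"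
proof -
  obtain \<epsilon> where "0 < \<epsilon>" and "\<forall>l\<in>{zm..zp}. \<forall>y. frm T l (0, y) (0, y) \<le> - \<epsilon> * (norm y)\<^sup>2"
    using assms(8) by blast
  then interpret negative_lower_block_embedded T "{zm..zp}" \<epsilon> I1 I2
    using assms(2-5) by unfold_locales auto
  have "mu \<in> {zm..zp}"
    using assms(11) by simp
  obtain \<delta> where "0 < \<delta>" and "\<And>l. l \<in> {zm..zp} \<Longrightarrow> l \<noteq> mu \<Longrightarrow> \<bar>l - mu\<bar> < \<delta> \<Longrightarrow>
      zero_in_resolvent (bul_dom T I1 I2 l) (bul T I1 I2 l)"
    using assms(12) unfolding bul_isolated_eigenvalue_def by blast
  note near_mu = refl \<open>mu \<in> {zm..zp}\<close> this assms(10)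
  have "bul_ker T I1 I2 mu \<noteq> {0}"
    using assms(12) unfolding bul_isolated_eigenvalue_def by blast
  thus ?thesis
    using schur_isolated_eigenvalue[OF near_mu] schur_negative_type[OF near_mu assms(7,6,14)]
      fin_dim_schur_ker[OF \<open>mu \<in> {zm..zp}\<close> assms(13)] by blast
qed

end
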